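(* Let $t$ be any integer and $G_j=G_j(a,b)$ a gibonacci sequence. If $p$ is a non-negative integer, then \[ \sum_{n=0}^\infty\binom{n+p}{p}\frac{H_nG_{n+t}}{2^n}=(H_p+\ln2)2^{p+1}G_{t+2p+2}+\frac{2^{p+2}}{\sqrt5}\bigl(G_{t+2p+3}+G_{t+2p+1}\bigr)\ln\alpha-2^{p+1}\sum_{k=1}^p\frac{G_{t+2p-2k+2}}{2^kk}. \] If $p$ is a non-negative even integer, then \begin{align*} \sum_{n=0}^\infty(-1)^n\binom{n+p}{p}\frac{H_nG_{n+t}}{2^n}&=\Bigl(\frac2{\sqrt5}\Bigr)^{p+1}\left(\frac{H_p-\ln(\sqrt5/2)}{\sqrt5}\bigl(G_{t-p}+G_{t-p-2}\bigr)-G_{t-p-1}\ln\alpha\right)\\ &\quad-\sum_{k=1}^{p/2}\frac{(4/5)^{p/2-k}}{5k}\left(G_{t+2k-p}+\frac{6k-1}{2k-1}G_{t+2k-p-2}\right), \end{align*} while if $p$ is an odd positive integer, then \begin{align*} \sum_{n=0}^\infty(-1)^n\binom{n+p}{p}\frac{H_nG_{n+t}}{2^n}&=\Bigl(\frac2{\sqrt5}\Bigr)^{p+1}\left(\bigl(H_p-\ln(\sqrt5/2)\bigr)G_{t-p-1}-\frac{\ln\alpha}{\sqrt5}\bigl(G_{t-p}+G_{t-p-2}\bigr)\right)\\ &\quad-\frac8{25}\sum_{k=1}^{(p-1)/2}\frac{(4/5)^{(p-1)/2-k}}{2k-1}\left(\frac{14k-5}{4k}G_{t+2k-p-1}+G_{t+2k-p-3}\right)-\frac{2(G_t+G_{t-2})}{5p}.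 \end{align*}
   Context: $H_n=\sum_{j=1}^n\frac1j$ ($H_0=0$). $\alpha=(1+\sqrt5)/2$, $\beta=-1/\alpha$. For numbers $a,b$ not both zero, the gibonacci sequence $G_j=G_j(a,b)$ is defined by $G_0=a$, $G_1=b$, $G_j=G_{j-1}+G_{j-2}$, extended to negative indices by $G_{-j}=G_{-(j-2)}-G_{-(j-1)}$; equivalently $G_j=\frac{(b-a\beta)\alpha^j+(a\alpha-b)\beta^j}{\alpha-\beta}$. Empty sums are $0$. *)

theory Defs
  imports "HOL-Analysis.Analysis"
begin

fun gib_pos :: "real \<Rightarrow> real \<Rightarrow> nat \<Rightarrow> real" where
  "gib_pos a b 0 = a"
| "gib_pos a b (Suc 0) = b"
| "gib_pos a b (Suc (Suc n)) = gib_pos a b (Suc n) + gib_pos a b n"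

text \<open>gib_neg a b j = G_{-j}, using G_{-j} = G_{-(j-2)} - G_{-(j-1)}.\<close>
fun gib_neg :: "real \<Rightarrow> real \<Rightarrow> nat \<Rightarrow> real" where
  "gib_neg a b 0 = a"
| "gib_neg a b (Suc 0) = b - a"
| "gib_neg a b (Suc (Suc n)) = gib_neg a b n - gib_neg a b (Suc n)"

definition gib :: "real \<Rightarrow> real \<Rightarrow> int \<Rightarrow> real" where
  "gib a b j = (if 0 \<le> j then gib_pos a b (nat j) else gib_neg a b (nat (- j)))"

definition golden :: real where "golden = (1 + sqrt 5) / 2"

end

theory Submission
  imports Defs
begin

text \<open>
  For \<open>\<bar>x\<bar> < 1\<close>, induction on \<open>p\<close>, using Cauchy products with the geometric series, gives
  \<open>\<Sum>n. (n + p choose p) H\<^sub>n x\<^sup>n\<close> in closed form as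
  \<open>(H\<^sub>p - ln (1 - x) - (\<Sum>k=1..p. (1 - x)\<^sup>k / k)) / (1 - x)\<^bsup>p+1\<^esup>\<close>.
  By Binet's formula it remains to evaluate this at \<open>\<plusminus>\<alpha>/2\<close> and \<open>\<plusminus>\<beta>/2\<close>, where
  \<open>1 - x\<close> is a constant times a power of \<open>\<alpha>\<close> or \<open>\<beta>\<close>: \<open>1 - \<alpha>/2 = \<alpha>\<^sup>-\<^sup>2/2\<close>,
  \<open>1 - \<beta>/2 = \<beta>\<^sup>-\<^sup>2/2\<close>, \<open>1 + \<alpha>/2 = \<surd>5 \<alpha>/2\<close> and \<open>1 + \<beta>/2 = -\<surd>5 \<beta>/2\<close>.
  In the alternating case the finite sums of the statement arise by adding the terms
  with \<open>k\<close> odd and \<open>k\<close> even in pairs.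
\<close>

section \<open>Power series with binomial coefficients and harmonic numbers\<close>

text \<open>The Cauchy product with the geometric series replaces coefficients by their partial
  sums. Since the coefficients are nonnegative, convergence at \<open>\<bar>x\<bar>\<close> is
  absolute convergence at \<open>x\<close>; this is why \<open>f\<close> is assumed on the whole
  interval.\<close>

lemma sums_partial_sums_geometric:
  fixes f :: "nat \<Rightarrow> real"
  assumes nonneg: "\<And>n. 0 \<le> f n"
    and f: "\<And>x. \<bar>x\<bar> < 1 \<Longrightarrow> (\<lambda>n. f n * x ^ n) sums F x"
    and x: "\<bar>x\<bar> < 1"
  shows "(\<lambda>n. (\<Sum>i\<le>n. f i) * x ^ n) sums (F x / (1 - x))"
proof -
  have "summable (\<lambda>n. f n * \<bar>x\<bar> ^ n)"
    using f[of "\<bar>x\<bar>"] x by (simp add: sums_iff)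
  then have "summable (\<lambda>n. norm (f n * x ^ n))"
    using nonneg by (simp add: abs_mult power_abs)
  moreover have "summable (\<lambda>n. norm (x ^ n))"
    using x by (simp add: power_abs)
  ultimately have "(\<lambda>n. \<Sum>i\<le>n. f i * x ^ i * x ^ (n - i)) sums
      ((\<Sum>n. f n * x ^ n) * (\<Sum>n. x ^ n))"
    by (rule Cauchy_product_sums)
  moreover have "(\<Sum>i\<le>n. f i * x ^ i * x ^ (n - i)) = (\<Sum>i\<le>n. f i) * x ^ n" for n
    unfolding sum_distrib_right
    by (intro sum.cong refl) (simp add: mult.assoc flip: power_add)
  moreover have "(\<Sum>n. f n * x ^ n) = F x"
    using f[OF x] by (simp add: sums_iff)
  moreover have "(\<Sum>n. x ^ n) = 1 / (1 - x)"
    using x by (simp add: suminf_geometric)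
  ultimately show ?thesis by simp
qed

text \<open>By the hockey-stick identity the coefficients for \<open>Suc p\<close> are the partial
  sums of those for \<open>p\<close>, so each induction step divides by
  \<open>1 - x\<close>.\<close>

lemma binomial_series_negative_sums:
  fixes x :: real
  assumes "\<bar>x\<bar> < 1"
  shows "(\<lambda>n. real ((n + p) choose p) * x ^ n) sums (1 / (1 - x) ^ (p + 1))"
  using assms
proof (induction p arbitrary: x)
  case 0
  then show ?case using geometric_sums[of x] by simp
next
  case (Suc p)
  have "(\<Sum>i\<le>n. real ((i + p) choose p)) = real ((n + Suc p) choose Suc p)" for n
    by (induction n) simp_all
  then show ?case
    using sums_partial_sums_geometric[of "\<lambda>n. real ((n + p) choose p)"
        "\<lambda>x. 1 / (1 - x) ^ (p + 1)", OF _ Suc.IH Suc.prems]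
    by (simp add: mult.commute)
qed

text \<open>The sum telescopes: by Pascal's rule, passing from \<open>n - 1\<close> to
  \<open>n\<close> raises the right-hand side by
  \<open>(n + p choose p) * harm n + (n + p choose Suc p) / n\<close>, and absorption turns the last
  quotient into \<open>(n + p choose p) / Suc p\<close>. The case \<open>i = 0\<close> is excluded
  because the right-hand side starts at \<open>harm 0 = 0\<close>.\<close>

lemma sum_binomial_harm:
  "(\<Sum>i\<le>n. real ((i + p) choose p) * harm i
      + (if i = 0 then 0 else real ((i + p) choose p) / real (Suc p)))
   = real ((n + Suc p) choose Suc p) * harm n"
proof (induction n)
  case 0
  show ?case by (simp add: harm_def)
next
  case (Suc n)
  have "(Suc p) * ((Suc n + p) choose Suc p) = Suc n * ((Suc n + p) choose p)"
    using binomial_absorb_comp[of "Suc n + p" p] Suc_times_binomial_eq[of "n + p" p]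
    by (simp add: mult.commute)
  then have "real (Suc p) * real ((Suc n + p) choose Suc p)
      = real (Suc n) * real ((Suc n + p) choose p)"
    by (metis of_nat_mult)
  then have abs: "real ((Suc n + p) choose p) / real (Suc p)
      = real ((Suc n + p) choose Suc p) / real (Suc n)"
    by (simp add: field_simps del: of_nat_Suc)
  have pascal: "real ((Suc n + Suc p) choose Suc p)
      = real ((Suc n + p) choose p) + real ((Suc n + p) choose Suc p)"
    by simp
  show ?case
    unfolding sum.atMost_Suc Suc.IH pascal using abs
    by (simp add: harm_Suc ring_distribs divide_inverse del: binomial_Suc_Suc of_nat_Suc)
qed

lemma binomial_harm_sums:
  fixes x :: real
  assumes "\<bar>x\<bar> < 1"
  shows "(\<lambda>n. real ((n + p) choose p) * harm n * x ^ n) sums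
     ((harm p - ln (1 - x) - (\<Sum>k=1..p. (1 - x) ^ k / real k)) / (1 - x) ^ (p + 1))"
  using assms
proof (induction p arbitrary: x)
  case 0
  \<comment> \<open>Since \<open>inverse 0 = 0\<close>, the logarithmic series may start at
    \<open>n = 0\<close>, and its coefficients have the harmonic numbers as partial sums.\<close>
  have "(\<lambda>n. inverse (real n) * x ^ n) sums (- ln (1 - x))" if "\<bar>x\<bar> < 1" for x :: real
    using sums_minus[OF ln_series'[of "- x"]] that by (simp add: field_simps)
  note * = sums_partial_sums_geometric[OF _ this 0]
  have "(\<Sum>i\<le>n. inverse (real i)) = harm n" for n
    unfolding harm_def by (intro sum.mono_neutral_right) auto
  then show ?case using * by (simp add: harm_def)
next
  case (Suc p)
  define f where "f = (\<lambda>i. real ((i + p) choose p) * harm i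
      + (if i = 0 then 0 else real ((i + p) choose p) / real (Suc p)))"
  \<comment> \<open>The generating function of \<open>f\<close>: the induction hypothesis plus the
    binomial series without its constant term 1, divided by \<open>Suc p\<close>.\<close>
  define F where "F = (\<lambda>x::real. (harm p - ln (1 - x) - (\<Sum>k=1..p. (1 - x) ^ k / real k))
       / (1 - x) ^ (p + 1) + (1 / (1 - x) ^ (p + 1) - 1) / real (Suc p))"
  have f: "(\<lambda>n. f n * x ^ n) sums F x" if x: "\<bar>x\<bar> < 1" for x
  proof -
    have "(\<lambda>n. real ((n + p) choose p) * x ^ n - (if n = 0 then 1 else 0)) sums
        (1 / (1 - x) ^ (p + 1) - 1)"
      by (intro sums_diff binomial_series_negative_sums[OF x] sums_single)
    from sums_add[OF Suc.IH[OF x] sums_divide[OF this, of "real (Suc p)"]]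
    show ?thesis unfolding F_def f_def
      by (rule sums_cong[THEN iffD1, rotated]) (auto simp: algebra_simps add_divide_distrib)
  qed
  have "0 \<le> f n" for n
    unfolding f_def by (simp add: harm_nonneg)
  from sums_partial_sums_geometric[of f F, OF this f Suc.prems]
  have "(\<lambda>n. real ((n + Suc p) choose Suc p) * harm n * x ^ n) sums (F x / (1 - x))"
    unfolding f_def sum_binomial_harm by simp
  moreover have "F x / (1 - x) = (harm (Suc p) - ln (1 - x)
      - (\<Sum>k=1..Suc p. (1 - x) ^ k / real k)) / (1 - x) ^ (Suc p + 1)"
  proof -
    have "1 - x \<noteq> 0" using Suc.prems by auto
    \<comment> \<open>Here \<open>q\<close> is \<open>(1 - x) ^ (p + 1)\<close>, \<open>P\<close> is
      \<open>Suc p\<close> and \<open>y\<close> is \<open>1 - x\<close>. The part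
      \<open>1 / q\<close> of the correction extends the harmonic number, and the part
      \<open>-1\<close> supplies the new last term of the finite sum.\<close>
    moreover have "((h - l - s) / q + (1 / q - 1) / P) / y
        = (h + inverse P - l - (s + q / P)) / (y * q)"
      if "y \<noteq> 0" "q \<noteq> 0" "P \<noteq> 0" for h l s q P y :: real
      using that by (simp add: divide_simps) (simp add: algebra_simps)
    ultimately show ?thesis unfolding F_def
      by (simp add: harm_Suc del: of_nat_Suc power_Suc) (simp del: of_nat_Suc)
  qed
  ultimately show ?case by simp
qed

text \<open>If \<open>1 / (1 - x) = c * w powi e\<close>, then every power of
  \<open>1 / (1 - x)\<close> times \<open>w powi t\<close> is a constant times a single power of
  \<open>w\<close>, as Binet's formula requires. Only the product \<open>c * w powi e\<close> has to
  be positive, for the logarithm, so that the negative root \<beta> is covered too.\<close>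

lemma binomial_harm_powi_sums:
  fixes w c x :: real and e t :: int
  assumes w: "w \<noteq> 0" and pos: "c * w powi e > 0"
    and x: "\<bar>x\<bar> < 1" "(1 - x) * (c * w powi e) = 1"
  shows "(\<lambda>n. real ((n + p) choose p) * harm n * x ^ n * w powi t) sums
     ((harm p + ln (c * w powi e)) * c ^ (p + 1) * w powi (t + e * int (p + 1))
      - (\<Sum>k=1..p. c ^ (p + 1 - k) * w powi (t + e * int (p + 1 - k)) / real k))"
proof -
  define z where "z = c * w powi e"
  have z: "z > 0" "1 - x = inverse z"
    using pos inverse_unique[of z "1 - x"] x(2) by (simp_all add: z_def mult.commute)
  have zpow: "z ^ m * w powi t = c ^ m * w powi (t + e * int m)" for m
    unfolding z_def using w
    by (simp add: power_mult_distrib power_int_add power_int_mult)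
  have "(harm p - ln (1 - x) - (\<Sum>k=1..p. (1 - x) ^ k / real k)) / (1 - x) ^ (p + 1)
      = (harm p + ln z) * z ^ (p + 1) - (\<Sum>k=1..p. z ^ (p + 1 - k) / real k)"
  proof -
    have "inverse z ^ k / real k * z ^ (p + 1) = z ^ (p + 1 - k) / real k"
      if "k \<in> {1..p}" for k
      using that z(1) by (simp add: power_diff field_simps del: power_Suc)
    then have "(\<Sum>k=1..p. inverse z ^ k / real k) * z ^ (p + 1)
        = (\<Sum>k=1..p. z ^ (p + 1 - k) / real k)"
      unfolding sum_distrib_right by (intro sum.cong refl) blast
    then show ?thesis
      unfolding z(2) using z(1)
      by (simp add: ln_inverse power_inverse divide_inverse left_diff_distrib del: power_Suc)
  qed
  moreover have "((harm p + ln z) * z ^ (p + 1) - (\<Sum>k=1..p. z ^ (p + 1 - k) / real k)) * w powi t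
      = (harm p + ln z) * c ^ (p + 1) * w powi (t + e * int (p + 1))
        - (\<Sum>k=1..p. c ^ (p + 1 - k) * w powi (t + e * int (p + 1 - k)) / real k)"
    unfolding left_diff_distrib sum_distrib_right mult.assoc times_divide_eq_left zpow ..
  ultimately show ?thesis
    using sums_mult2[OF binomial_harm_sums[OF x(1), of p], of "w powi t"]
    unfolding z_def by (simp only:)
qed

section \<open>The golden ratio, its conjugate and Binet's formula\<close>

lemma golden_gt_1: "golden > 1"
  unfolding golden_def using real_less_rsqrt[of 1 5] by simp

lemma golden_less_2: "golden < 2"
  unfolding golden_def using real_less_lsqrt[of 3 5] by simp

lemma golden_square: "golden ^ 2 = golden + 1"
  unfolding golden_def by (simp add: power2_eq_square field_simps)

lemma sqrt5_golden: "sqrt 5 = 2 * golden - 1"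
  unfolding golden_def by (simp add: field_simps)

text \<open>The number \<beta>, written without division; \<open>inverse_golden\<close> gives the
  form \<open>-1 / \<alpha>\<close>.\<close>

definition golden_conj :: real where "golden_conj = 1 - golden"

lemma golden_conj_bounds: "-1 < golden_conj" "golden_conj < 0"
  using golden_gt_1 golden_less_2 by (simp_all add: golden_conj_def)

lemma golden_conj_square: "golden_conj ^ 2 = golden_conj + 1"
  using golden_square unfolding golden_conj_def by (simp add: power2_eq_square algebra_simps)

lemma golden_mult_conj: "golden * golden_conj = -1"
  using golden_square unfolding golden_conj_def by (simp add: power2_eq_square algebra_simps)

lemma inverse_golden: "inverse golden = - golden_conj" "inverse golden_conj = - golden"
  using golden_mult_conj by (auto intro!: inverse_unique simp: mult.commute)

lemma golden_nonzero: "golden \<noteq> 0" "golden_conj \<noteq> 0"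
  using golden_gt_1 golden_conj_bounds by auto

text \<open>The coefficients of \<alpha> and \<beta> in Binet's formula, with
  \<open>\<alpha> - \<beta> = sqrt 5\<close>.\<close>

definition gibA :: "real \<Rightarrow> real \<Rightarrow> real" where "gibA a b = (b - a * golden_conj) / sqrt 5"
definition gibB :: "real \<Rightarrow> real \<Rightarrow> real" where "gibB a b = (a * golden - b) / sqrt 5"

lemma gib_0_1:
  "a = gibA a b + gibB a b"
  "b = gibA a b * golden + gibB a b * golden_conj"
proof -
  have *: "golden - golden_conj = sqrt 5"
    by (simp add: sqrt5_golden golden_conj_def)
  have "gibA a b + gibB a b = a * (golden - golden_conj) / sqrt 5"
    unfolding gibA_def gibB_def by (simp add: algebra_simps flip: add_divide_distrib)
  then show "a = gibA a b + gibB a b" by (simp add: *)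
  have "gibA a b * golden + gibB a b * golden_conj = b * (golden - golden_conj) / sqrt 5"
    unfolding gibA_def gibB_def by (simp add: algebra_simps flip: add_divide_distrib)
  then show "b = gibA a b * golden + gibB a b * golden_conj" by (simp add: *)
qed

lemma gib_binet: "gib a b j = gibA a b * golden powi j + gibB a b * golden_conj powi j"
proof -
  have "gib_pos a b n = gibA a b * golden ^ n + gibB a b * golden_conj ^ n" for n
  proof (induction n rule: induct_nat_012)
    case (ge2 n)
    have "golden ^ Suc (Suc n) = golden ^ Suc n + golden ^ n"
         "golden_conj ^ Suc (Suc n) = golden_conj ^ Suc n + golden_conj ^ n"
      using golden_square golden_conj_square
      by (simp_all add: power2_eq_square algebra_simps flip: mult.assoc)
    then show ?case using ge2 by (simp add: algebra_simps)
  qed (use gib_0_1[where a = a and b = b] in simp_all)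
  moreover
  \<comment> \<open>The inverses of \<alpha> and \<beta> are \<open>-\<beta>\<close> and
    \<open>-\<alpha>\<close>, the roots of \<open>x^2 = 1 - x\<close>, which is the characteristic
    equation of \<open>gib_neg\<close>.\<close>
  have "gib_neg a b n = gibA a b * (- golden_conj) ^ n + gibB a b * (- golden) ^ n" for n
  proof (induction n rule: induct_nat_012)
    case 1
    show ?case using gib_0_1[where a = a and b = b] unfolding golden_conj_def by (simp add: algebra_simps)
  next
    case (ge2 n)
    have "(- golden) ^ Suc (Suc n) = (- golden) ^ n - (- golden) ^ Suc n"
         "(- golden_conj) ^ Suc (Suc n) = (- golden_conj) ^ n - (- golden_conj) ^ Suc n"
      using golden_square golden_conj_square
      by (simp_all add: power2_eq_square algebra_simps flip: mult.assoc)
    then show ?case using ge2 by (simp add: algebra_simps)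
  qed (use gib_0_1[where a = a and b = b] in simp_all)
  ultimately show ?thesis
    unfolding gib_def power_int_def inverse_golden by simp
qed


text \<open>For \<alpha> the sum of the root and its inverse is
  \<open>\<alpha> - \<beta> = sqrt 5\<close>, for \<beta> it is \<open>-sqrt 5\<close>. Adding the
  two neighbours therefore flips the sign of the \<beta> part, which expresses differences of the
  Binet terms by gibonacci numbers.\<close>

lemma gib_neighbours:
  "gib a b (j + 1) + gib a b (j - 1)
   = sqrt 5 * (gibA a b * golden powi j - gibB a b * golden_conj powi j)"
proof -
  have "golden powi (j + 1) + golden powi (j - 1) = sqrt 5 * golden powi j"
       "golden_conj powi (j + 1) + golden_conj powi (j - 1) = - sqrt 5 * golden_conj powi j"
    using golden_nonzero unfolding sqrt5_golden
    by (simp_all add: power_int_add power_int_diff divide_inverse inverse_golden)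
       (simp_all add: golden_conj_def algebra_simps)
  moreover have "gib a b (j + 1) + gib a b (j - 1)
      = gibA a b * (golden powi (j + 1) + golden powi (j - 1))
        + gibB a b * (golden_conj powi (j + 1) + golden_conj powi (j - 1))"
    unfolding gib_binet by (simp add: algebra_simps)
  ultimately show ?thesis by (simp add: algebra_simps)
qed

section \<open>The series without alternating signs\<close>

text \<open>The term \<open>ln golden\<close> enters with opposite signs at \<alpha> and \<beta>, so
  its coefficient becomes a sum of two neighbours of the index.\<close>

lemma ln_golden_conj_square: "ln (2 * golden_conj ^ 2) = ln 2 - 2 * ln golden"
proof -
  have c: "golden_conj = - inverse golden"
    by (simp add: inverse_golden)
  show ?thesis
    unfolding c power2_minus using golden_gt_1
    by (simp add: ln_mult ln_realpow ln_inverse)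
qed

lemma gib_binomial_harm_sums:
  "(\<lambda>n. real ((n + p) choose p) * harm n * gib a b (int n + t) / 2 ^ n) sums
      ((harm p + ln 2) * 2 ^ (p + 1) * gib a b (t + 2 * int p + 2)
       + 2 ^ (p + 2) / sqrt 5 * (gib a b (t + 2 * int p + 3) + gib a b (t + 2 * int p + 1)) * ln golden
       - 2 ^ (p + 1) * (\<Sum>k=1..p. gib a b (t + 2 * int p - 2 * int k + 2) / (2 ^ k * real k)))"
proof -
  define A B where "A = gibA a b" and "B = gibB a b"
  \<comment> \<open>The value at \<open>x = w / 2\<close> times \<open>w powi t\<close>, with
    \<open>c = 2\<close> and \<open>e = 2\<close>, for both roots \<open>w\<close> of
    \<open>w^2 = w + 1\<close>.\<close>
  define V where "V = (\<lambda>w::real. (harm p + ln (2 * w powi 2)) * 2 ^ (p + 1) * w powi (t + 2 * int (p + 1))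
      - (\<Sum>k=1..p. 2 ^ (p + 1 - k) * w powi (t + 2 * int (p + 1 - k)) / real k))"
  have 1: "(\<lambda>n. real ((n + p) choose p) * harm n * (golden / 2) ^ n * golden powi t) sums V golden"
    unfolding V_def
  proof (rule binomial_harm_powi_sums)
    show "(1 - golden / 2) * (2 * golden powi 2) = 1"
      using golden_square by (simp add: power_int_def field_simps power2_eq_square)
  qed (use golden_gt_1 golden_less_2 in auto)
  have 2: "(\<lambda>n. real ((n + p) choose p) * harm n * (golden_conj / 2) ^ n * golden_conj powi t)
      sums V golden_conj"
    unfolding V_def
  proof (rule binomial_harm_powi_sums)
    show "(1 - golden_conj / 2) * (2 * golden_conj powi 2) = 1"
      using golden_conj_square by (simp add: power_int_def field_simps power2_eq_square)
  qed (use golden_conj_bounds golden_nonzero in auto)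
  have *: "(\<lambda>n. real ((n + p) choose p) * harm n * gib a b (int n + t) / 2 ^ n) sums
      (A * V golden + B * V golden_conj)"
    using sums_add[OF sums_mult[OF 1, of A] sums_mult[OF 2, of B]] golden_nonzero
    by (simp add: gib_binet power_int_add power_divide field_simps A_def B_def)
  have V: "V w = (harm p + ln (2 * w ^ 2)) * 2 ^ (p + 1) * w powi (t + 2 * int p + 2)
      - 2 ^ (p + 1) * (\<Sum>k=1..p. w powi (t + 2 * int p - 2 * int k + 2) / (2 ^ k * real k))" for w
  proof -
    have "(2::real) ^ (p + 1 - k) * w powi (t + 2 * int (p + 1 - k)) / real k
        = 2 ^ (p + 1) * (w powi (t + 2 * int p - 2 * int k + 2) / (2 ^ k * real k))"
      if "k \<in> {1..p}" for k
    proof -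
      have e1: "(2::real) ^ (p + 1 - k) = 2 ^ (p + 1) / 2 ^ k"
        using that by (simp add: power_diff del: power_Suc)
      have e2: "t + 2 * int (p + 1 - k) = t + 2 * int p - 2 * int k + 2"
        using that by auto
      show ?thesis unfolding e1 e2 by simp
    qed
    then show ?thesis
      unfolding V_def sum_distrib_left by (simp add: algebra_simps)
  qed
  have lng: "ln (2 * golden ^ 2) = ln 2 + 2 * ln golden"
    using golden_gt_1 by (simp add: ln_mult ln_realpow)
  \<comment> \<open>The factor \<open>2 * ln golden\<close> from the logarithms, the power
    \<open>2 ^ (p + 1)\<close> and the \<open>sqrt 5\<close> here combine to
    \<open>2 ^ (p + 2) / sqrt 5\<close>.\<close>
  have nb: "gib a b (t + 2 * int p + 3) + gib a b (t + 2 * int p + 1)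
     = sqrt 5 * (A * golden powi (t + 2 * int p + 2) - B * golden_conj powi (t + 2 * int p + 2))"
    using gib_neighbours[of a b "t + 2 * int p + 2"] by (simp add: A_def B_def algebra_simps)
  have s: "(\<Sum>k=1..p. gib a b (t + 2 * int p - 2 * int k + 2) / (2 ^ k * real k))
     = A * (\<Sum>k=1..p. golden powi (t + 2 * int p - 2 * int k + 2) / (2 ^ k * real k))
     + B * (\<Sum>k=1..p. golden_conj powi (t + 2 * int p - 2 * int k + 2) / (2 ^ k * real k))"
    unfolding gib_binet sum_distrib_left sum.distrib[symmetric]
    by (intro sum.cong refl) (simp add: A_def B_def add_divide_distrib)
  have b: "gib a b (t + 2 * int p + 2)
     = A * golden powi (t + 2 * int p + 2) + B * golden_conj powi (t + 2 * int p + 2)"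
    by (simp add: gib_binet A_def B_def)
  show ?thesis
    using * unfolding V lng ln_golden_conj_square nb s b by (simp add: algebra_simps)
qed

section \<open>The series with alternating signs\<close>

text \<open>Both values below have Binet form \<open>A \<alpha>\<^sup>j \<plusminus> B \<beta>\<^sup>j\<close>, with the sign \<open>+\<close>
  for \<open>e = True\<close>.\<close>
definition gib_signed :: "real \<Rightarrow> real \<Rightarrow> bool \<Rightarrow> int \<Rightarrow> real" where
  "gib_signed a b e j =
     (if e then gib a b j else (gib a b (j + 1) + gib a b (j - 1)) / sqrt 5)"

lemma gib_signed_binet:
  "gib_signed a b e j
   = gibA a b * golden powi j + (if e then 1 else -1) * (gibB a b * golden_conj powi j)"
  unfolding gib_signed_def gib_neighbours by (simp add: gib_binet)

text \<open>Here \<open>e = -1\<close>, with \<open>c = 2 / sqrt 5\<close> at \<alpha> and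
  \<open>c = -2 / sqrt 5\<close> at \<beta>. Thus \<open>c ^ m\<close> gives the \<beta> part the
  sign of \<open>(-1) ^ m\<close>, and the parity of the exponent selects the case of
  \<open>gib_signed\<close>. The \<open>ln golden\<close> term has opposite signs at the two roots
  and so takes the opposite parity.\<close>

lemma gib_alternating_binomial_harm_sums:
  "(\<lambda>n. (-1) ^ n * real ((n + p) choose p) * harm n * gib a b (int n + t) / 2 ^ n) sums
      ((2 / sqrt 5) ^ (p + 1) *
         ((harm p - ln (sqrt 5 / 2)) * gib_signed a b (odd p) (t - int p - 1)
          - ln golden * gib_signed a b (even p) (t - int p - 1))
       - (\<Sum>k=1..p. (2 / sqrt 5) ^ (p + 1 - k)
            * gib_signed a b (even (p + 1 - k)) (t - int (p + 1 - k)) / real k))"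
proof -
  define A B where "A = gibA a b" and "B = gibB a b"
  define V where "V = (\<lambda>c w::real. (harm p + ln (c * w powi (-1))) * c ^ (p + 1) * w powi (t + (-1) * int (p + 1))
      - (\<Sum>k=1..p. c ^ (p + 1 - k) * w powi (t + (-1) * int (p + 1 - k)) / real k))"
  have s5: "2 * golden - 1 > 0" using golden_gt_1 by simp
  have 1: "(\<lambda>n. real ((n + p) choose p) * harm n * (- golden / 2) ^ n * golden powi t) sums
      V (2 / sqrt 5) golden"
    unfolding V_def
  proof (rule binomial_harm_powi_sums)
    show "(1 - (- golden / 2)) * (2 / sqrt 5 * golden powi - 1) = 1"
      using golden_square golden_nonzero s5 unfolding sqrt5_golden
      by (simp add: field_simps power2_eq_square)
  qed (use golden_gt_1 golden_less_2 in auto)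
  have 2: "(\<lambda>n. real ((n + p) choose p) * harm n * (- golden_conj / 2) ^ n * golden_conj powi t) sums
      V (- (2 / sqrt 5)) golden_conj"
    unfolding V_def
  proof (rule binomial_harm_powi_sums)
    show "(1 - (- golden_conj / 2)) * (- (2 / sqrt 5) * golden_conj powi - 1) = 1"
    proof -
      \<comment> \<open>As \<open>\<beta> = 1 - \<alpha>\<close>, the factor
        \<open>1 + \<beta> / 2\<close> is \<open>(3 - \<alpha>) / 2\<close>, and the inverse of
        \<beta> is \<open>-\<alpha>\<close>.\<close>
      have "(3 - golden) * golden = 2 * golden - 1"
        using golden_square by (simp add: power2_eq_square algebra_simps)
      moreover have "(1 - (- golden_conj / 2)) * (- (2 / sqrt 5) * golden_conj powi - 1)
          = (3 - golden) * golden / sqrt 5"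
        by (simp add: inverse_golden) (simp add: golden_conj_def field_simps)
      ultimately show ?thesis using s5 unfolding sqrt5_golden by simp
    qed
    show "0 < - (2 / sqrt 5) * golden_conj powi - 1"
      using golden_gt_1 by (simp add: inverse_golden)
  qed (use golden_conj_bounds golden_nonzero in auto)
  have *: "(\<lambda>n. (-1) ^ n * real ((n + p) choose p) * harm n * gib a b (int n + t) / 2 ^ n) sums
      (A * V (2 / sqrt 5) golden + B * V (- (2 / sqrt 5)) golden_conj)"
  proof (rule sums_cong[THEN iffD1, OF _ sums_add[OF sums_mult[OF 1, of A] sums_mult[OF 2, of B]]])
    fix n
    have neg: "(- w / 2) ^ n = (-1) ^ n * (w ^ n / 2 ^ n)" for w :: real
      by (metis power_divide power_minus times_divide_eq_right)
    show "A * (real ((n + p) choose p) * harm n * (- golden / 2) ^ n * golden powi t)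
      + B * (real ((n + p) choose p) * harm n * (- golden_conj / 2) ^ n * golden_conj powi t)
      = (-1) ^ n * real ((n + p) choose p) * harm n * gib a b (int n + t) / 2 ^ n"
      unfolding neg using golden_nonzero
      by (simp add: gib_binet power_int_add field_simps A_def B_def)
  qed
  have ln1: "ln (2 / sqrt 5 * golden powi (-1)) = - ln (sqrt 5 / 2) - ln golden"
    using golden_gt_1 by (simp add: ln_mult ln_div ln_inverse)
  have ln2: "ln (- (2 / sqrt 5) * golden_conj powi (-1)) = - ln (sqrt 5 / 2) + ln golden"
    using golden_gt_1 by (simp add: inverse_golden ln_mult ln_div)
  have exp: "t + (-1) * int m = t - int m" for m by simp
  have neg: "(- (2 / sqrt 5)) ^ m = (if even m then 1 else -1) * (2 / sqrt 5) ^ m" for m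
    by simp
  have "A * V (2 / sqrt 5) golden + B * V (- (2 / sqrt 5)) golden_conj =
      (2 / sqrt 5) ^ (p + 1) *
         ((harm p - ln (sqrt 5 / 2)) * gib_signed a b (odd p) (t - int (p + 1))
          - ln golden * gib_signed a b (even p) (t - int (p + 1)))
      - (\<Sum>k=1..p. (2 / sqrt 5) ^ (p + 1 - k)
            * gib_signed a b (even (p + 1 - k)) (t - int (p + 1 - k)) / real k)"
  proof -
    have "(\<Sum>k=1..p. (2 / sqrt 5) ^ (p + 1 - k)
            * gib_signed a b (even (p + 1 - k)) (t - int (p + 1 - k)) / real k)
       = A * (\<Sum>k=1..p. (2 / sqrt 5) ^ (p + 1 - k) * golden powi (t - int (p + 1 - k)) / real k)
       + B * (\<Sum>k=1..p. (- (2 / sqrt 5)) ^ (p + 1 - k) * golden_conj powi (t - int (p + 1 - k)) / real k)"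
      unfolding sum_distrib_left sum.distrib[symmetric] gib_signed_binet neg
        A_def[symmetric] B_def[symmetric]
      by (intro sum.cong refl) (simp add: algebra_simps add_divide_distrib diff_divide_distrib del: power_Suc)
    moreover have "A * ((harm p + (- ln (sqrt 5 / 2) - ln golden)) * (2 / sqrt 5) ^ (p + 1)
          * golden powi (t - int (p + 1)))
        + B * ((harm p + (- ln (sqrt 5 / 2) + ln golden)) * (- (2 / sqrt 5)) ^ (p + 1)
          * golden_conj powi (t - int (p + 1)))
       = (2 / sqrt 5) ^ (p + 1) *
         ((harm p - ln (sqrt 5 / 2)) * gib_signed a b (odd p) (t - int (p + 1))
          - ln golden * gib_signed a b (even p) (t - int (p + 1)))"
      unfolding gib_signed_binet neg A_def[symmetric] B_def[symmetric]
      by (cases "even p") (simp_all add: algebra_simps del: power_Suc)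
    ultimately show ?thesis
      unfolding V_def exp ln1 ln2 by (simp only: right_diff_distrib)
  qed
  moreover have "t - int (p + 1) = t - int p - 1" by simp
  ultimately show ?thesis using * by (simp only:)
qed

section \<open>Pairing the terms of the finite sums\<close>

lemma sum_pairs: "(\<Sum>k=1..2 * m. f k) = (\<Sum>k=1..m. f (2 * k - 1) + f (2 * k))"
  for f :: "nat \<Rightarrow> 'a::comm_monoid_add"
  by (induction m) (simp_all add: add.assoc)

text \<open>An odd power of \<open>2 / sqrt 5\<close> always meets the \<open>1 / sqrt 5\<close> in
  \<open>gib_signed\<close>, so all coefficients of the finite sums become rational.\<close>

lemma power_2_div_sqrt5:
  "(2 / sqrt 5) ^ (2 * r) = (4 / 5) ^ r"
  "(2 / sqrt 5) ^ (2 * r + 1) / sqrt 5 = 2 / 5 * (4 / 5) ^ r"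
proof -
  have "(2 / sqrt 5) ^ 2 = 4 / 5" by (simp add: power_divide)
  then show "(2 / sqrt 5) ^ (2 * r) = (4 / 5) ^ r" by (simp only: power_mult)
  then show "(2 / sqrt 5) ^ (2 * r + 1) / sqrt 5 = 2 / 5 * (4 / 5) ^ r" by simp
qed

lemma gib_signed_power_even:
  "(2 / sqrt 5) ^ (2 * r) * gib_signed a b (even (2 * r)) j = (4 / 5) ^ r * gib a b j"
  by (simp add: gib_signed_def power_2_div_sqrt5)

lemma gib_signed_power_odd:
  "(2 / sqrt 5) ^ (2 * r + 1) * gib_signed a b (even (2 * r + 1)) j
   = 2 / 5 * (4 / 5) ^ r * (gib a b (j + 1) + gib a b (j - 1))"
proof -
  have "(2 / sqrt 5) ^ (2 * r + 1) * gib_signed a b (even (2 * r + 1)) j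
     = (2 / sqrt 5) ^ (2 * r + 1) / sqrt 5 * (gib a b (j + 1) + gib a b (j - 1))"
    by (simp add: gib_signed_def)
  then show ?thesis unfolding power_2_div_sqrt5 .
qed

text \<open>The terms \<open>2 * k - 1\<close> and \<open>2 * k\<close> have exponents
  \<open>2 * (m - k) + 2\<close> and \<open>2 * (m - k) + 1\<close>: the first contributes one
  gibonacci number, the second two neighbours, one of them the same number.\<close>

lemma sum_gib_signed_even:
  fixes t :: int and m :: nat
  defines "p \<equiv> 2 * m"
  shows "(\<Sum>k=1..p. (2 / sqrt 5) ^ (p + 1 - k)
            * gib_signed a b (even (p + 1 - k)) (t - int (p + 1 - k)) / real k)
    = (\<Sum>k=1..m. (4 / 5) ^ (m - k) / (5 * real k) *
            (gib a b (t + 2 * int k - int p)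
             + (6 * real k - 1) / (2 * real k - 1) * gib a b (t + 2 * int k - int p - 2)))"
  (is "(\<Sum>k=1..p. ?f k) = (\<Sum>k=1..m. ?g k)")
proof -
  have "?f (2 * k - 1) + ?f (2 * k) = ?g k" if k: "k \<in> {1..m}" for k
  proof -
    define r where "r = m - k"
    have m: "m = r + k" using k by (simp add: r_def)
    define g0 g2 where "g0 = gib a b (t - 2 * int r)" and "g2 = gib a b (t - 2 * int r - 2)"
    have e: "p + 1 - (2 * k - 1) = 2 * (r + 1)" "p + 1 - 2 * k = 2 * r + 1"
      "t + 2 * int k - int p = t - 2 * int r"
      using k by (auto simp: p_def m)
    have k1: "real (2 * k - 1) = 2 * real k - 1" "2 * real k - 1 > 0"
      using k by (auto simp: of_nat_diff)
    have f1: "?f (2 * k - 1) = 4 / 5 * (4 / 5) ^ r * g2 / (2 * real k - 1)"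
      unfolding e gib_signed_power_even k1 g2_def by (simp add: algebra_simps)
    have f2: "?f (2 * k) = 2 / 5 * (4 / 5) ^ r * (g0 + g2) / (2 * real k)"
      unfolding e gib_signed_power_odd g2_def g0_def by (simp add: algebra_simps)
    have g: "?g k = (4 / 5) ^ r / (5 * real k) * (g0 + (6 * real k - 1) / (2 * real k - 1) * g2)"
      unfolding e r_def[symmetric] g0_def g2_def ..
    \<comment> \<open>The coefficient of \<open>g2\<close> comes from
      \<open>4 / (2 * k - 1) + 1 / k\<close>, whose numerator is
      \<open>4 * k + (2 * k - 1) = 6 * k - 1\<close>.\<close>
    have "4 / 5 * q * g2 / (2 * real k - 1) + 2 / 5 * q * (g0 + g2) / (2 * real k)
        = q / (5 * real k) * (g0 + (6 * real k - 1) / (2 * real k - 1) * g2)" for q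
      using k k1(2) by (simp add: divide_simps) (simp add: algebra_simps)
    then show ?thesis unfolding f1 f2 g .
  qed
  then show ?thesis
    unfolding p_def sum_pairs by (intro sum.cong refl) (simp only: p_def)
qed

text \<open>Now the odd exponent comes first in each pair, and the term \<open>k = p\<close> with
  exponent 1 is left over; it is the separate last summand.\<close>

lemma sum_gib_signed_odd:
  fixes t :: int and m :: nat
  defines "p \<equiv> 2 * m + 1"
  shows "(\<Sum>k=1..p. (2 / sqrt 5) ^ (p + 1 - k)
            * gib_signed a b (even (p + 1 - k)) (t - int (p + 1 - k)) / real k)
    = 8 / 25 * (\<Sum>k=1..m. (4 / 5) ^ (m - k) / (2 * real k - 1) *
            ((14 * real k - 5) / (4 * real k) * gib a b (t + 2 * int k - int p - 1)
             + gib a b (t + 2 * int k - int p - 3)))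
       + 2 * (gib a b t + gib a b (t - 2)) / (5 * real p)"
  (is "(\<Sum>k=1..p. ?f k) = 8 / 25 * (\<Sum>k=1..m. ?g k) + ?h")
proof -
  have "?f (2 * k - 1) + ?f (2 * k) = 8 / 25 * ?g k" if k: "k \<in> {1..m}" for k
  proof -
    define r where "r = m - k"
    have m: "m = r + k" using k by (simp add: r_def)
    define g1 g3 where "g1 = gib a b (t - 2 * int r - 2)" and "g3 = gib a b (t - 2 * int r - 4)"
    have e: "p + 1 - (2 * k - 1) = 2 * (r + 1) + 1" "p + 1 - 2 * k = 2 * (r + 1)"
      "t + 2 * int k - int p - 1 = t - 2 * int r - 2" "t + 2 * int k - int p - 3 = t - 2 * int r - 4"
      using k by (auto simp: p_def m)
    have k1: "real (2 * k - 1) = 2 * real k - 1" "2 * real k - 1 > 0"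
      using k by (auto simp: of_nat_diff)
    have f1: "?f (2 * k - 1) = 2 / 5 * (4 / 5 * (4 / 5) ^ r) * (g1 + g3) / (2 * real k - 1)"
      unfolding e gib_signed_power_odd k1 g1_def g3_def by (simp add: algebra_simps)
    have f2: "?f (2 * k) = 4 / 5 * (4 / 5) ^ r * g1 / (2 * real k)"
      unfolding e gib_signed_power_even g1_def by (simp add: algebra_simps)
    have g: "?g k = (4 / 5) ^ r / (2 * real k - 1) * ((14 * real k - 5) / (4 * real k) * g1 + g3)"
      unfolding e r_def[symmetric] g1_def g3_def ..
    \<comment> \<open>After taking out \<open>8 / 25\<close> and \<open>1 / (2 * k - 1)\<close>, the
      coefficient of \<open>g1\<close> is \<open>1 + 5 * (2 * k - 1) / (4 * k)\<close>, with
      numerator \<open>14 * k - 5\<close>.\<close>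
    have "2 / 5 * (4 / 5 * q) * (g1 + g3) / (2 * real k - 1) + 4 / 5 * q * g1 / (2 * real k)
        = 8 / 25 * (q / (2 * real k - 1) * ((14 * real k - 5) / (4 * real k) * g1 + g3))" for q
      using k k1(2) by (simp add: divide_simps) (simp add: algebra_simps)
    then show ?thesis unfolding f1 f2 g .
  qed
  then have "(\<Sum>k=1..2 * m. ?f k) = 8 / 25 * (\<Sum>k=1..m. ?g k)"
    unfolding sum_pairs sum_distrib_left by (intro sum.cong refl)
  moreover have "?f p = ?h"
  proof -
    have "(2 / sqrt 5) * gib_signed a b False (t - 1) = 2 / 5 * (gib a b t + gib a b (t - 2))"
      using gib_signed_power_odd[of 0 a b "t - 1"] by simp
    then have "(2 / sqrt 5) * gib_signed a b False (t - 1) / real p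
        = 2 / 5 * (gib a b t + gib a b (t - 2)) / real p"
      by (rule arg_cong)
    then show ?thesis by simp
  qed
  moreover have "(\<Sum>k=1..p. ?f k) = (\<Sum>k=1..2 * m. ?f k) + ?f p"
    by (simp add: p_def)
  ultimately show ?thesis by simp
qed

section \<open>The identities for arbitrary, even and odd \<open>p\<close>\<close>

theorem theorem19:
  fixes a b :: real and t :: int and p :: nat
  assumes "a \<noteq> 0 \<or> b \<noteq> 0"
  defines "G \<equiv> gib a b"
  shows
   "(\<lambda>n. real ((n + p) choose p) * harm n * G (int n + t) / 2 ^ n) sums
      ((harm p + ln 2) * 2 ^ (p + 1) * G (t + 2 * int p + 2)
       + 2 ^ (p + 2) / sqrt 5 * (G (t + 2 * int p + 3) + G (t + 2 * int p + 1)) * ln golden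
       - 2 ^ (p + 1) * (\<Sum>k=1..p. G (t + 2 * int p - 2 * int k + 2) / (2 ^ k * real k)))
   \<and>
   (even p \<longrightarrow>
    (\<lambda>n. (-1) ^ n * real ((n + p) choose p) * harm n * G (int n + t) / 2 ^ n) sums
      ((2 / sqrt 5) ^ (p + 1) *
         ((harm p - ln (sqrt 5 / 2)) / sqrt 5 * (G (t - int p) + G (t - int p - 2))
          - G (t - int p - 1) * ln golden)
       - (\<Sum>k=1..p div 2. (4 / 5) ^ (p div 2 - k) / (5 * real k) *
            (G (t + 2 * int k - int p)
             + (6 * real k - 1) / (2 * real k - 1) * G (t + 2 * int k - int p - 2)))))
   \<and>
   (odd p \<longrightarrow>
    (\<lambda>n. (-1) ^ n * real ((n + p) choose p) * harm n * G (int n + t) / 2 ^ n) sums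
      ((2 / sqrt 5) ^ (p + 1) *
         ((harm p - ln (sqrt 5 / 2)) * G (t - int p - 1)
          - ln golden / sqrt 5 * (G (t - int p) + G (t - int p - 2)))
       - 8 / 25 * (\<Sum>k=1..(p - 1) div 2. (4 / 5) ^ ((p - 1) div 2 - k) / (2 * real k - 1) *
            ((14 * real k - 5) / (4 * real k) * G (t + 2 * int k - int p - 1)
             + G (t + 2 * int k - int p - 3)))
       - 2 * (G t + G (t - 2)) / (5 * real p)))"
  (is "?S1 \<and> (_ \<longrightarrow> ?S2) \<and> (_ \<longrightarrow> ?S3)")
proof (intro conjI impI)
  show "?S1"
    unfolding G_def by (rule gib_binomial_harm_sums)
next
  assume "even p"
  then obtain m where m: "p = 2 * m" by blast
  \<comment> \<open>For even \<open>p\<close> the exponent \<open>p + 1\<close> is odd, so the main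
    term carries the neighbour sum and \<open>ln golden\<close> the single value; for odd
    \<open>p\<close> the roles are exchanged.\<close>
  have "gib_signed a b (odd p) (t - int p - 1)
      = (gib a b (t - int p) + gib a b (t - int p - 2)) / sqrt 5"
    "gib_signed a b (even p) (t - int p - 1) = gib a b (t - int p - 1)"
    using \<open>even p\<close> by (simp_all add: gib_signed_def)
  note * = gib_alternating_binomial_harm_sums[of p a b t, unfolded this]
  have "p div 2 = m" by (simp add: m)
  then show "?S2"
    using * sum_gib_signed_even[where t = t and m = m and a = a and b = b, folded m]
    unfolding G_def by (simp add: mult.commute)
next
  assume "odd p"
  then obtain m where m: "p = 2 * m + 1" by (rule oddE)
  have "gib_signed a b (even p) (t - int p - 1)
      = (gib a b (t - int p) + gib a b (t - int p - 2)) / sqrt 5"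
    "gib_signed a b (odd p) (t - int p - 1) = gib a b (t - int p - 1)"
    using \<open>odd p\<close> by (simp_all add: gib_signed_def)
  note * = gib_alternating_binomial_harm_sums[of p a b t, unfolded this]
  have "(p - 1) div 2 = m" by (simp add: m)
  then show "?S3"
    using * sum_gib_signed_odd[where t = t and m = m and a = a and b = b, folded m]
    unfolding G_def by (simp add: diff_diff_eq)
qed

end
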